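(* For any integer $k\geq 1$, if $\varepsilon=c/k^2$ with $0<c<1$, then $F_2(\varepsilon,2^k+1)>\frac{c}{24}\varepsilon$. Consequently, if $0<\varepsilon<(\log_2 n)^{-2}$, then $F_2(\varepsilon,n)=\Omega((\log n)^2\varepsilon^2)$; that is, there is an absolute constant $c_0>0$ such that $F_2(\varepsilon,n)\geq c_0(\log n)^2\varepsilon^2$ for all integers $n\geq 3$ and all $0<\varepsilon<(\log_2 n)^{-2}$.
   Context: A Steiner topology for $n$ terminals is a (graph-theoretic) tree $\mathcal{T}$ with $n$ special vertices $t_1,\dots,t_n$, called terminals, all of degree at most $3$, and all other vertices, called Steiner points, of degree exactly $3$. It is full if all terminals have degree $1$. Given a family $p_1,\dots,p_n$ of points in $\mathbb{R}^d$ (repetitions allowed), a Steiner tree with topology $\mathcal{T}$ on these points is a representation of $\mathcal{T}$ in $\mathbb{R}^d$ in which $t_i$ is represented by $p_i$, each Steiner point by an arbitrary point of $\mathbb{R}^d$, and each edge by a straight-line segment; points may coincide (so edges may have length $0$; such edges, and trees containing them, are called degenerate) and edges may cross. The length $L(T)$ is the sum of the Euclidean lengths of the edges. Angles are measured in $[0,\pi]$. For $\varepsilon\geq 0$, an $\varepsilon$-approximate Steiner tree is a tree with a Steiner topology such that at each Steiner point all three angles spanned by pairs of incident edges belong to $[2\pi/3-\varepsilon,2\pi/3+\varepsilon]$ (in particular these angles are defined, so edges at Steiner points have positive length). $\mathcal{A}_\varepsilon^d(n)$ denotes the set of all $\varepsilon$-approximate Steiner trees in $\mathbb{R}^d$ with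 full Steiner topology on $n$ terminals. For a tree $T$ in $\mathbb{R}^d$ with Steiner topology $\mathcal{T}$, $S(T)$ denotes the (unique) shortest tree in $\mathbb{R}^d$ on the terminals of $T$ with topology $\mathcal{T}$, where degenerate trees are allowed. Define \[F_d(\varepsilon,n)=\sup\left\{\frac{L(T)-L(S(T))}{L(S(T))}: T\in\mathcal{A}_\varepsilon^d(n)\right\}.\] *)

theory Defs
  imports "HOL-Analysis.Analysis"
begin

section \<open>Trees as finite simple graphs\<close>

definition simple_graph :: "'v set \<Rightarrow> 'v set set \<Rightarrow> bool" where
  "simple_graph V E \<longleftrightarrow> finite V \<and> (\<forall>e\<in>E. e \<subseteq> V \<and> card e = 2)"

definition graph_connected :: "'v set \<Rightarrow> 'v set set \<Rightarrow> bool" where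
  "graph_connected V E \<longleftrightarrow> V \<noteq> {} \<and> (\<forall>u\<in>V. \<forall>v\<in>V. (u, v) \<in> {(x, y). {x, y} \<in> E}\<^sup>*)"

definition graph_cycle :: "'v set set \<Rightarrow> 'v list \<Rightarrow> bool" where
  "graph_cycle E xs \<longleftrightarrow> 3 \<le> length xs \<and> distinct xs \<and>
     (\<forall>i<length xs. {xs ! i, xs ! (Suc i mod length xs)} \<in> E)"

definition graph_tree :: "'v set \<Rightarrow> 'v set set \<Rightarrow> bool" where
  "graph_tree V E \<longleftrightarrow> simple_graph V E \<and> graph_connected V E \<and> (\<nexists>xs. graph_cycle E xs)"

definition graph_degree :: "'v set set \<Rightarrow> 'v \<Rightarrow> nat" where
  "graph_degree E v = card {e \<in> E. v \<in> e}"

section \<open>Steiner topologies\<close>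

text \<open>Vertices are natural numbers; since every finite graph is isomorphic to one on natural
  numbers, this is no restriction, and it makes the collection of all topologies a set.
  The list \<open>terminals\<close> is \<open>t\<^sub>1, \<dots>, t\<^sub>n\<close>.\<close>

record topology =
  vertices :: "nat set"
  edges :: "nat set set"
  terminals :: "nat list"

definition steiner_points :: "topology \<Rightarrow> nat set" where
  "steiner_points G = vertices G - set (terminals G)"

definition steiner_topology :: "nat \<Rightarrow> topology \<Rightarrow> bool" where
  "steiner_topology n G \<longleftrightarrow>
     graph_tree (vertices G) (edges G) \<and>
     length (terminals G) = n \<and> distinct (terminals G) \<and> set (terminals G) \<subseteq> vertices G \<and>
     (\<forall>t\<in>set (terminals G). graph_degree (edges G) t \<le> 3) \<and>
     (\<forall>s\<in>steiner_points G. graph_degree (edges G) s = 3)"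

definition full_topology :: "topology \<Rightarrow> bool" where
  "full_topology G \<longleftrightarrow> (\<forall>t\<in>set (terminals G). graph_degree (edges G) t = 1)"

section \<open>Steiner trees in Euclidean space\<close>

text \<open>A tree in \<open>\<real>\<^sup>d\<close> with topology \<open>G\<close> is given by the positions \<open>p\<close> of the vertices of \<open>G\<close>,
  without any injectivity requirement, so that edges may be degenerate or cross; the values
  of \<open>p\<close> outside the vertices of \<open>G\<close> play no role. In \<open>tree_length\<close>, \<open>Min\<close> and \<open>Max\<close> pick out
  the two endpoints of an edge.\<close>

type_synonym 'd placement = "nat \<Rightarrow> real ^ 'd"

definition tree_length :: "topology \<Rightarrow> 'd::finite placement \<Rightarrow> real" where
  "tree_length G p = (\<Sum>e\<in>edges G. dist (p (Min e)) (p (Max e)))"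

text \<open>The angle in \<open>[0, \<pi>]\<close> between two nonzero vectors.\<close>

definition vec_angle :: "'a::real_inner \<Rightarrow> 'a \<Rightarrow> real" where
  "vec_angle x y = arccos (x \<bullet> y / (norm x * norm y))"

definition approx_steiner :: "real \<Rightarrow> topology \<Rightarrow> 'd::finite placement \<Rightarrow> bool" where
  "approx_steiner \<epsilon> G p \<longleftrightarrow>
     (\<forall>s\<in>steiner_points G.
        (\<forall>u. {s, u} \<in> edges G \<longrightarrow> p u \<noteq> p s) \<and>
        (\<forall>u v. {s, u} \<in> edges G \<longrightarrow> {s, v} \<in> edges G \<longrightarrow> u \<noteq> v \<longrightarrow>
           vec_angle (p u - p s) (p v - p s) \<in> {2 * pi / 3 - \<epsilon> .. 2 * pi / 3 + \<epsilon>}))"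

definition full_approx_trees :: "real \<Rightarrow> nat \<Rightarrow> (topology \<times> 'd::finite placement) set" where
  "full_approx_trees \<epsilon> n =
     {(G, p). steiner_topology n G \<and> full_topology G \<and> approx_steiner \<epsilon> G p}"

text \<open>\<open>S(T)\<close>: a shortest tree among all trees with the same topology and the same terminals.
  Only its length is used below, and that does not depend on which minimizer is chosen.\<close>

definition shortest_tree :: "topology \<Rightarrow> 'd::finite placement \<Rightarrow> 'd placement" where
  "shortest_tree G p = arg_min (tree_length G) (\<lambda>q. \<forall>t\<in>set (terminals G). q t = p t)"

text \<open>The dimension \<open>d\<close> is the cardinality of the index type \<open>'d\<close>. The supremum is taken in the
  extended reals, so that it is meaningful without a boundedness assumption. In \<open>ereal\<close>,
  \<open>x / 0 = \<infinity>\<close> for \<open>x > 0\<close> and \<open>0 / 0 = 0\<close>; a zero denominator can only occur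
  for \<open>n \<le> 2\<close> or \<open>\<epsilon> \<ge> 2 * pi / 3\<close>.\<close>

definition steiner_F :: "'d::finite itself \<Rightarrow> real \<Rightarrow> nat \<Rightarrow> ereal" where
  "steiner_F _ \<epsilon> n =
     (SUP (G, p) \<in> (full_approx_trees \<epsilon> n :: (topology \<times> 'd placement) set).
        ereal (tree_length G p - tree_length G (shortest_tree G p)) /
        ereal (tree_length G (shortest_tree G p)))"

end

theory Submission
  imports Defs
begin

text \<open>
  Take a complete binary tree of depth \<open>k\<close> whose edges at depth \<open>j\<close> have length \<open>2\<^sup>-\<^sup>j\<close>, so that
  each of the \<open>k + 1\<close> levels has total length \<open>1\<close>. Were the edges at depth \<open>j\<close> turned by \<open>\<plusminus> \<pi> / 3\<close>
  relative to their parents, all angles would be \<open>2 * \<pi> / 3\<close>. Turn them by a further \<open>\<epsilon>\<close> per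
  level, always in the same sense: the edges at depth \<open>j\<close> are then rotated by
  \<open>\<theta>\<^sub>j = (j - k / 2) * \<epsilon>\<close> away from the exact directions (after an overall rotation), and the
  three angles at each Steiner point are \<open>2 * \<pi> / 3 - \<epsilon>\<close>, \<open>2 * \<pi> / 3 + \<epsilon>\<close> and \<open>2 * \<pi> / 3\<close>.

  The same terminals are joined by a tree with the same topology all of whose edges do have the
  exact directions. It arises by moving each Steiner point of depth \<open>j\<close> perpendicularly to the
  exact direction of its parent edge by
  \<open>- (sin \<theta>\<^sub>0 + \<dots> + sin \<theta>\<^sub>j) / 2\<^sup>j\<close>; this vanishes at depth \<open>k\<close> because
  \<open>\<theta>\<^sub>0, \<dots>, \<theta>\<^sub>k\<close> is symmetric about \<open>0\<close>. The moved edge at depth \<open>j\<close> is the projection of the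
  old one, of length \<open>cos \<theta>\<^sub>j / 2\<^sup>j\<close>, plus a correction that has opposite signs for two siblings
  and so cancels in the sum. The condition \<open>k\<^sup>2 * \<epsilon> < 1\<close> ensures that no edge is reversed. The
  total length thus drops from \<open>k + 1\<close> to \<open>\<Sum>j\<le>k. cos \<theta>\<^sub>j\<close>, and since
  \<open>\<Sum>j\<le>k. \<theta>\<^sub>j\<^sup>2 = \<epsilon>\<^sup>2 * k * (k + 1) * (k + 2) / 12\<close>, the relative gain is about
  \<open>\<epsilon>\<^sup>2 * k * (k + 2) / 24\<close>; the surplus over \<open>\<epsilon>\<^sup>2 * k\<^sup>2 / 24\<close> absorbs the error terms.

  For a number \<open>n \<ge> 2\<^sup>k + 1\<close> of terminals, further edges of a tiny length \<open>\<eta>\<close> with exact angles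
  are attached below depth \<open>k\<close>; they are the same in both trees. Numbering the vertices as in a
  binary heap, where \<open>i\<close> is joined to \<open>i div 2\<close>, makes the construction uniform in \<open>n\<close>.
  As the comparison tree bounds the shortest tree from above once a shortest tree exists,
  the existence of the minimum is shown as well, by projecting onto a ball and compactness.\<close>

section \<open>Existence of shortest trees\<close>

lemma tree_length_nonneg: "tree_length G p \<ge> 0"
  unfolding tree_length_def by (intro sum_nonneg) auto

lemma continuous_on_tree_length:
  "continuous_on S (tree_length G :: 'd::finite placement \<Rightarrow> real)"
proof -
  have coord: "continuous_on S (\<lambda>p :: 'd placement. p i)" for i
    by (rule continuous_on_subset[OF continuous_on_product_coordinates]) auto
  show ?thesis
    unfolding tree_length_def
    by (intro continuous_intros coord)
qed

text \<open>The projection onto a ball that contains all terminals is a contraction, so only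
  placements in that ball matter; these form a compact set by Tychonoff's theorem.\<close>

lemma shortest_tree_exists:
  fixes p :: "'d::finite placement"
  obtains q where "\<And>t. t \<in> set (terminals G) \<Longrightarrow> q t = p t"
    and "\<And>r. (\<And>t. t \<in> set (terminals G) \<Longrightarrow> r t = p t) \<Longrightarrow> tree_length G q \<le> tree_length G r"
proof -
  have "bounded (p ` set (terminals G))"
    by (simp add: finite_imp_bounded)
  then obtain B where B: "\<And>t. t \<in> set (terminals G) \<Longrightarrow> norm (p t) \<le> B"
    by (auto simp: bounded_iff)
  define R where "R = max B 0"
  let ?C = "cball (0 :: real ^ 'd) R"
  have R: "p t \<in> ?C" if "t \<in> set (terminals G)" for t
    using B[OF that] by (simp add: R_def)
  have C: "convex ?C" "closed ?C" "?C \<noteq> {}"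
    by (auto simp: R_def)
  define K where "K = (\<lambda>v. if v \<in> set (terminals G) then {p v} else ?C)"
  have "compactin (product_topology (\<lambda>i. euclidean) UNIV) (PiE UNIV K)"
    unfolding compactin_PiE by (auto simp: K_def)
  then have compact: "compact (PiE UNIV K)"
    by (simp add: euclidean_product_topology)
  have "(\<lambda>v. if v \<in> set (terminals G) then p v else 0) \<in> PiE UNIV K"
    by (auto simp: K_def R_def PiE_def)
  then have "PiE UNIV K \<noteq> {}"
    by blast
  from continuous_attains_inf[OF compact this continuous_on_tree_length[of _ G]]
  obtain q where q: "q \<in> PiE UNIV K"
    and min: "\<And>r. r \<in> PiE UNIV K \<Longrightarrow> tree_length G q \<le> tree_length G r"
    by blast
  show thesis
  proof
    show "q t = p t" if "t \<in> set (terminals G)" for t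
      using PiE_mem[OF q, of t] that by (simp add: K_def)
    show "tree_length G q \<le> tree_length G r"
      if r: "\<And>t. t \<in> set (terminals G) \<Longrightarrow> r t = p t" for r
    proof -
      let ?r = "\<lambda>v. closest_point ?C (r v)"
      have "?r v \<in> K v" for v
        using r R closest_point_in_set[OF C(2,3)] by (simp add: K_def closest_point_self del: mem_cball)
      then have "?r \<in> PiE UNIV K"
        by auto
      then have "tree_length G q \<le> tree_length G ?r"
        by (rule min)
      also have "\<dots> \<le> tree_length G r"
        unfolding tree_length_def by (intro sum_mono closest_point_lipschitz C)
      finally show ?thesis .
    qed
  qed
qed

lemma tree_length_shortest_le:
  fixes p q :: "'d::finite placement"
  assumes "\<And>t. t \<in> set (terminals G) \<Longrightarrow> q t = p t"
  shows "tree_length G (shortest_tree G p) \<le> tree_length G q"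
proof -
  let ?P = "\<lambda>q. \<forall>t\<in>set (terminals G). q t = p t"
  obtain q0 where "\<And>t. t \<in> set (terminals G) \<Longrightarrow> q0 t = p t"
    and "\<And>r. (\<And>t. t \<in> set (terminals G) \<Longrightarrow> r t = p t) \<Longrightarrow> tree_length G q0 \<le> tree_length G r"
    using shortest_tree_exists[of G p] by metis
  then have "is_arg_min (tree_length G) ?P q0"
    by (fastforce simp: is_arg_min_linorder)
  then have "is_arg_min (tree_length G) ?P (shortest_tree G p)"
    unfolding shortest_tree_def arg_min_def by (rule someI[where P = "is_arg_min (tree_length G) ?P"])
  then show ?thesis
    using assms by (auto simp: is_arg_min_linorder)
qed

lemma steiner_F_gt:
  fixes p q :: "'d::finite placement"
  assumes tree: "(G, p) \<in> full_approx_trees \<epsilon> n"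
    and q: "\<And>t. t \<in> set (terminals G) \<Longrightarrow> q t = p t"
    and less: "tree_length G q < tree_length G p"
    and le: "tree_length G q \<le> b"
    and x: "x * b < tree_length G p - tree_length G q"
    and "x \<ge> 0"
  shows "ereal x < steiner_F TYPE('d) \<epsilon> n"
proof -
  let ?S = "tree_length G (shortest_tree G p)"
  have S: "?S \<le> tree_length G q"
    using q by (rule tree_length_shortest_le)
  have "ereal x < ereal (tree_length G p - ?S) / ereal ?S"
  proof (cases "?S = 0")
    case True
    then have "ereal (tree_length G p - ?S) / ereal ?S = \<infinity>"
      using S less tree_length_nonneg[of G q] by (simp add: divide_ereal_def)
    then show ?thesis
      by simp
  next
    case False
    then have pos: "?S > 0"
      using tree_length_nonneg[of G "shortest_tree G p"] by simp
    have "x * ?S \<le> x * b"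
      using S le \<open>x \<ge> 0\<close> by (intro mult_left_mono) auto
    with x S have "x * ?S < tree_length G p - ?S"
      by linarith
    with pos show ?thesis
      by (simp add: field_simps)
  qed
  also have "\<dots> \<le> steiner_F TYPE('d) \<epsilon> n"
    unfolding steiner_F_def by (rule SUP_upper2[OF tree]) auto
  finally show ?thesis .
qed

section \<open>The heap topology\<close>

text \<open>The vertices are \<open>0, \<dots>, 2 * n - 3\<close>, each \<open>i \<ge> 1\<close> being joined to \<open>i div 2\<close>. The terminals are
  the root \<open>0\<close>, which has the single child \<open>1\<close>, and the leaves \<open>n - 1, \<dots>, 2 * n - 3\<close>; each Steiner
  point \<open>i\<close> has the parent \<open>i div 2\<close> and the children \<open>2 * i\<close> and \<open>2 * i + 1\<close>.\<close>

definition heap_edge :: "nat \<Rightarrow> nat set" where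
  "heap_edge i = {i, i div 2}"

definition heap_topology :: "nat \<Rightarrow> topology" where
  "heap_topology n = \<lparr>vertices = {..2 * n - 3}, edges = heap_edge ` {1..2 * n - 3},
     terminals = 0 # [n - 1..<2 * n - 2]\<rparr>"

lemma heap_edge_Max: "Max (heap_edge i) = i"
  and heap_edge_Min: "Min (heap_edge i) = i div 2"
  by (auto simp: heap_edge_def max_def min_def)

lemma inj_on_heap_edge: "inj_on heap_edge A"
  by (metis heap_edge_Max inj_onI)

lemma doubleton_eq_heap_edge:
  "{u, v} = heap_edge i \<longleftrightarrow> u = i \<and> v = i div 2 \<or> v = i \<and> u = i div 2"
  by (auto simp: heap_edge_def doubleton_eq_iff)

lemma heap_connected: "graph_connected {..N} (heap_edge ` {1..N})"
proof -
  let ?R = "{(x, y). {x, y} \<in> heap_edge ` {1..N}}"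
  have sym: "sym ?R"
    by (auto simp: sym_def insert_commute)
  have root: "(u, 0) \<in> ?R\<^sup>*" if "u \<le> N" for u
    using that
  proof (induction u rule: less_induct)
    case (less u)
    show ?case
    proof (cases "u = 0")
      case False
      then have "(u, u div 2) \<in> ?R"
        using less.prems by (auto simp: heap_edge_def)
      moreover have "(u div 2, 0) \<in> ?R\<^sup>*"
        using False less.prems by (intro less.IH) auto
      ultimately show ?thesis
        by (rule converse_rtrancl_into_rtrancl)
    qed simp
  qed
  have "(u, v) \<in> ?R\<^sup>*" if "u \<le> N" "v \<le> N" for u v
    using root[OF that(1)] symD[OF sym_rtrancl[OF sym] root[OF that(2)]] by (rule rtrancl_trans)
  then show ?thesis
    by (auto simp: graph_connected_def)
qed

text \<open>The largest vertex of a cycle would have two smaller neighbours, but \<open>i div 2\<close> is the only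
  smaller neighbour of \<open>i\<close>.\<close>

lemma heap_acyclic: "\<not> graph_cycle (heap_edge ` {1..N}) xs"
proof
  assume cycle: "graph_cycle (heap_edge ` {1..N}) xs"
  define l where "l = length xs"
  have l: "l \<ge> 3" and dist: "distinct xs"
    and edge: "\<And>i. i < l \<Longrightarrow> {xs ! i, xs ! (Suc i mod l)} \<in> heap_edge ` {1..N}"
    using cycle by (auto simp: graph_cycle_def l_def)
  have "xs \<noteq> []"
    using l by (auto simp: l_def)
  then have "Max (set xs) \<in> set xs"
    by (intro Max_in) auto
  then obtain a where a: "a < l" "xs ! a = Max (set xs)"
    by (auto simp: in_set_conv_nth l_def)
  have parent: "xs ! b = xs ! a div 2"
    if "{xs ! a, xs ! b} \<in> heap_edge ` {1..N}" "b < l" for b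
  proof -
    have "xs ! b \<le> xs ! a"
      using that a by (auto simp: l_def intro!: Max_ge)
    with that show ?thesis
      by (auto simp: doubleton_eq_heap_edge)
  qed
  define b where "b = Suc a mod l"
  define c where "c = (if a = 0 then l - 1 else a - 1)"
  have bl: "b < l" and cl: "c < l" and ca: "Suc c mod l = a"
    using a l by (auto simp: b_def c_def)
  have bc: "b \<noteq> c"
  proof (cases "Suc a = l")
    case True
    then show ?thesis
      using l by (auto simp: b_def c_def)
  next
    case False
    then have "b = Suc a"
      using a by (simp add: b_def)
    then show ?thesis
      using l False by (auto simp: c_def)
  qed
  have "xs ! b = xs ! a div 2"
    using edge[OF a(1)] bl by (intro parent) (auto simp: b_def)
  moreover have "xs ! c = xs ! a div 2"
    using edge[OF cl] cl by (intro parent) (auto simp: ca insert_commute)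
  ultimately show False
    using bc dist bl cl nth_eq_iff_index_eq[of xs b c] by (simp add: l_def)
qed

lemma heap_tree: "graph_tree {..N} (heap_edge ` {1..N})"
proof -
  have "card (heap_edge i) = 2" if "i \<ge> 1" for i
    using that by (simp add: heap_edge_def)
  moreover have "heap_edge i \<subseteq> {..N}" if "i \<le> N" for i
    using that by (auto simp: heap_edge_def)
  ultimately show ?thesis
    using heap_connected[of N] heap_acyclic[of N]
    by (auto simp: graph_tree_def simple_graph_def)
qed

lemma heap_degree:
  "graph_degree (heap_edge ` {1..N}) v = card {i \<in> {1..N}. i = v \<or> i div 2 = v}"
proof -
  have "{e \<in> heap_edge ` {1..N}. v \<in> e} = heap_edge ` {i \<in> {1..N}. i = v \<or> i div 2 = v}"
    by (auto simp: heap_edge_def)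
  then show ?thesis
    by (simp add: graph_degree_def card_image[OF inj_on_heap_edge])
qed

lemma heap_steiner_points:
  assumes "n \<ge> 3"
  shows "steiner_points (heap_topology n) = {1..n - 2}"
  using assms by (auto simp: steiner_points_def heap_topology_def)

lemma heap_terminal_degree:
  assumes "n \<ge> 3" "t \<in> set (terminals (heap_topology n))"
  shows "graph_degree (edges (heap_topology n)) t = 1"
proof -
  have "{i \<in> {1..2 * n - 3}. i = t \<or> i div 2 = t} = {if t = 0 then 1 else t}"
    using assms by (auto simp: heap_topology_def)
  then show ?thesis
    by (simp add: heap_topology_def heap_degree del: One_nat_def)
qed

lemma heap_full_steiner_topology:
  assumes "n \<ge> 3"
  shows "steiner_topology n (heap_topology n)" "full_topology (heap_topology n)"
proof -
  have "graph_degree (edges (heap_topology n)) s = 3" if "s \<in> steiner_points (heap_topology n)" for s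
  proof -
    have s: "1 \<le> s" "s \<le> n - 2"
      using that heap_steiner_points[OF assms] by auto
    have "{i \<in> {1..2 * n - 3}. i = s \<or> i div 2 = s} = {s, 2 * s, 2 * s + 1}"
      using s assms by auto
    then show ?thesis
      using s by (simp add: heap_topology_def heap_degree del: One_nat_def)
  qed
  then show "steiner_topology n (heap_topology n)"
    using heap_tree[of "2 * n - 3"] heap_terminal_degree[OF assms] assms
    by (auto simp: steiner_topology_def heap_topology_def)
  show "full_topology (heap_topology n)"
    using heap_terminal_degree[OF assms] by (auto simp: full_topology_def)
qed

lemma heap_tree_length:
  "tree_length (heap_topology n) p = (\<Sum>i = 1..2 * n - 3. dist (p (i div 2)) (p i))"
  by (simp add: tree_length_def heap_topology_def sum.reindex[OF inj_on_heap_edge]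
      heap_edge_Max heap_edge_Min)

lemma heap_neighbours:
  assumes "{s, u} \<in> edges (heap_topology n)" "s \<ge> 1"
  shows "u = s div 2 \<or> u = 2 * s \<or> u = 2 * s + 1"
  using assms by (auto simp: heap_topology_def doubleton_eq_heap_edge)

lemma sum_heap_children:
  fixes f :: "nat \<Rightarrow> 'a::comm_monoid_add"
  shows "(\<Sum>i = 1..2 * m + 1. f i) = f 1 + (\<Sum>i = 1..m. f (2 * i) + f (2 * i + 1))"
  by (induction m) (auto simp: ac_simps)

lemma sum_heap_levels:
  fixes f :: "nat \<Rightarrow> 'a::semiring_1"
  shows "(\<Sum>i = 1..<2 ^ K. f (floor_log i)) = (\<Sum>j<K. 2 ^ j * f j)"
proof (induction K)
  case (Suc K)
  have "{1..<2 ^ Suc K} = {1..<2 ^ K} \<union> {2 ^ K..<2 ^ Suc K :: nat}"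
    by (simp add: ivl_disj_un)
  then have "(\<Sum>i = 1..<2 ^ Suc K. f (floor_log i)) =
      (\<Sum>i = 1..<2 ^ K. f (floor_log i)) + (\<Sum>i = 2 ^ K..<2 ^ Suc K. f (floor_log i))"
    by (simp add: sum.union_disjoint)
  also have "(\<Sum>i = 2 ^ K..<2 ^ Suc K. f (floor_log i)) = (\<Sum>i = 2 ^ K..<2 ^ Suc K :: nat. f K)"
  proof (intro sum.cong refl)
    fix i :: nat
    assume i: "i \<in> {2 ^ K..<2 ^ Suc K}"
    moreover have "(0 :: nat) < 2 ^ K"
      by simp
    ultimately have "i > 0"
      by auto
    with i have "floor_log i = K"
      by (intro floor_log_eqI) auto
    then show "f (floor_log i) = f K"
      by simp
  qed
  also have "\<dots> = 2 ^ K * f K"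
    by simp
  finally show ?case
    using Suc by simp
qed simp

section \<open>Complex coordinates\<close>

text \<open>The standard isometry from the complex numbers onto the plane.\<close>

definition plane_of_complex :: "complex \<Rightarrow> real ^ 2" where
  "plane_of_complex z = vector [Re z, Im z]"

lemma plane_of_complex_diff:
  "plane_of_complex x - plane_of_complex y = plane_of_complex (x - y)"
  by (simp add: plane_of_complex_def vec_eq_iff forall_2)

lemma inner_plane_of_complex: "plane_of_complex x \<bullet> plane_of_complex y = x \<bullet> y"
  by (simp add: plane_of_complex_def inner_vec_def sum_2 inner_complex_def)

lemma norm_plane_of_complex: "norm (plane_of_complex x) = norm x"
  by (simp add: norm_eq_sqrt_inner inner_plane_of_complex)

lemma dist_plane_of_complex: "dist (plane_of_complex x) (plane_of_complex y) = dist x y"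
  by (simp add: dist_norm plane_of_complex_diff norm_plane_of_complex)

lemma vec_angle_commute: "vec_angle x y = vec_angle y x"
  by (simp add: vec_angle_def inner_commute mult.commute)

lemma vec_angle_plane_rcis:
  assumes "a > 0" "b > 0"
  shows "vec_angle (plane_of_complex (rcis a \<alpha>)) (plane_of_complex (rcis b \<beta>)) = arccos (cos (\<alpha> - \<beta>))"
proof -
  have "rcis a \<alpha> \<bullet> rcis b \<beta> = a * b * cos (\<alpha> - \<beta>)"
    by (simp add: inner_complex_def cos_diff algebra_simps)
  then show ?thesis
    using assms by (simp add: vec_angle_def inner_plane_of_complex norm_plane_of_complex)
qed

section \<open>Trigonometric estimates\<close>

lemma twice_abs_partial_sum_le:
  fixes a :: "nat \<Rightarrow> real"
  assumes "(\<Sum>j\<le>k. a j) = 0" "m \<le> k"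
  shows "2 * \<bar>\<Sum>j\<le>m. a j\<bar> \<le> (\<Sum>j\<le>k. \<bar>a j\<bar>)"
proof -
  have split: "(\<Sum>j\<le>k. f j) = (\<Sum>j\<le>m. f j) + (\<Sum>j\<in>{m<..k}. f j)" for f :: "nat \<Rightarrow> real"
  proof -
    have "{..k} = {..m} \<union> {m<..k}"
      using \<open>m \<le> k\<close> by auto
    then show ?thesis
      by (simp add: sum.union_disjoint disjoint_iff)
  qed
  have "(\<Sum>j\<in>{m<..k}. a j) = - (\<Sum>j\<le>m. a j)"
    using assms(1) split[of a] by (simp add: add_eq_0_iff)
  then have "\<bar>\<Sum>j\<le>m. a j\<bar> \<le> (\<Sum>j\<in>{m<..k}. \<bar>a j\<bar>)"
    by (metis abs_minus_cancel sum_abs)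
  moreover have "\<bar>\<Sum>j\<le>m. a j\<bar> \<le> (\<Sum>j\<le>m. \<bar>a j\<bar>)"
    by (rule sum_abs)
  ultimately show ?thesis
    using split[of "\<lambda>j. \<bar>a j\<bar>"] by linarith
qed

lemma one_minus_cos_eq: "1 - cos x = 2 * (sin (x / 2))\<^sup>2" for x :: real
  using cos_double_sin[of "x / 2"] by simp

lemma cos_ge_one_minus_square: "cos x \<ge> 1 - x\<^sup>2 / 2" for x :: real
proof -
  have "(sin (x / 2))\<^sup>2 \<le> (x / 2)\<^sup>2"
    using abs_sin_x_le_abs_x[of "x / 2"] unfolding abs_le_square_iff .
  then show ?thesis
    using one_minus_cos_eq[of x] by (simp add: power_divide)
qed

lemma one_minus_cos_ge:
  fixes x :: real
  assumes "\<bar>x\<bar> \<le> 1"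
  shows "1 - cos x \<ge> x\<^sup>2 / 2 * (1 - x\<^sup>2 / 12)"
proof -
  define y where "y = \<bar>x\<bar> / 2"
  have y: "0 \<le> y" "y \<le> 1 / 2"
    using assms by (auto simp: y_def)
  have "\<bar>sin y - y\<bar> \<le> y ^ 3 / 6"
    using Maclaurin_sin_bound[of y 3] y by (simp add: eval_nat_numeral sin_coeff_def)
  then have "sin y \<ge> y - y ^ 3 / 6"
    by linarith
  moreover have "y ^ 3 / 6 \<le> y"
  proof -
    have "y ^ 3 \<le> y * 1"
      using y power_decreasing[of 1 3 y] by simp
    then show ?thesis
      using y by linarith
  qed
  ultimately have "(y - y ^ 3 / 6)\<^sup>2 \<le> (sin y)\<^sup>2"
    by (intro power_mono) auto
  moreover have "(y - y ^ 3 / 6)\<^sup>2 = y\<^sup>2 * (1 - y\<^sup>2 / 3) + (y ^ 3 / 6)\<^sup>2"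
    by (simp add: power2_eq_square power3_eq_cube algebra_simps)
  moreover have "1 - cos x = 2 * (sin y)\<^sup>2"
    using one_minus_cos_eq[of "\<bar>x\<bar>"] by (simp add: y_def)
  ultimately have "1 - cos x \<ge> 2 * (y\<^sup>2 * (1 - y\<^sup>2 / 3))"
    using zero_le_power2[of "y ^ 3 / 6"] by linarith
  then show ?thesis
    by (simp add: y_def power_divide)
qed

text \<open>The angle \<open>\<theta>\<^sub>j\<close> by which the edges at depth \<open>j\<close> deviate from the exact directions. It stays
  constant beyond depth \<open>k\<close>, so that the angles there are exact.\<close>

definition turn :: "nat \<Rightarrow> real \<Rightarrow> nat \<Rightarrow> real" where
  "turn k \<epsilon> j = (real (min j k) - real k / 2) * \<epsilon>"

lemma sum_sin_turn: "(\<Sum>j\<le>k. sin (turn k \<epsilon> j)) = 0"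
proof -
  have "sin (turn k \<epsilon> (Suc k - Suc j)) = - sin (turn k \<epsilon> j)" if "j < Suc k" for j
  proof -
    have "turn k \<epsilon> (Suc k - Suc j) = - turn k \<epsilon> j"
      using that by (simp add: turn_def of_nat_diff algebra_simps min_def)
    then show ?thesis
      by simp
  qed
  then have "(\<Sum>j<Suc k. sin (turn k \<epsilon> (Suc k - Suc j))) = - (\<Sum>j<Suc k. sin (turn k \<epsilon> j))"
    unfolding sum_negf[symmetric] by (intro sum.cong) auto
  then have "(\<Sum>j<Suc k. sin (turn k \<epsilon> j)) = 0"
    unfolding sum.nat_diff_reindex[where g = "\<lambda>j. sin (turn k \<epsilon> j)"] by linarith
  then show ?thesis
    by (simp only: lessThan_Suc_atMost)
qed

lemma sum_turn_square: "(\<Sum>j\<le>k. (turn k \<epsilon> j)\<^sup>2) = \<epsilon>\<^sup>2 * real k * (real k + 1) * (real k + 2) / 12"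
proof -
  have squares: "6 * (\<Sum>j\<le>m. (real j - a)\<^sup>2)
      = real m * (real m + 1) * (2 * real m + 1) - 6 * a * real m * (real m + 1) + 6 * (real m + 1) * a\<^sup>2"
    for m and a :: real
    by (induction m) (auto simp: power2_eq_square algebra_simps)
  have "(\<Sum>j\<le>k. (turn k \<epsilon> j)\<^sup>2) = \<epsilon>\<^sup>2 * (\<Sum>j\<le>k. (real j - real k / 2)\<^sup>2)"
    unfolding sum_distrib_left
    by (intro sum.cong) (auto simp: turn_def min_def power_mult_distrib)
  also have "(\<Sum>j\<le>k. (real j - real k / 2)\<^sup>2) = real k * (real k + 1) * (real k + 2) / 12"
    using squares[where m = k and a = "real k / 2"] by (simp add: power2_eq_square algebra_simps)
  finally show ?thesis
    by (simp add: mult.assoc)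
qed

context
  fixes k :: nat and \<epsilon> :: real
  assumes k: "k \<ge> 1" and eps_pos: "\<epsilon> > 0" and eps_small: "(real k)\<^sup>2 * \<epsilon> < 1"
begin

lemma k_eps_le: "real k * \<epsilon> < 1 / real k" "real k * \<epsilon> < 1"
proof -
  show *: "real k * \<epsilon> < 1 / real k"
    using k eps_small by (simp add: field_simps power2_eq_square)
  have "1 / real k \<le> 1"
    using k by simp
  with * show "real k * \<epsilon> < 1"
    by linarith
qed

lemma abs_turn_le: "\<bar>turn k \<epsilon> j\<bar> \<le> real k * \<epsilon> / 2"
proof -
  have "\<bar>real (min j k) - real k / 2\<bar> \<le> real k / 2"
    using min.cobounded2[of j k] of_nat_0_le_iff[of "min j k", where 'a = real] by linarith
  then have "\<bar>real (min j k) - real k / 2\<bar> * \<epsilon> \<le> real k / 2 * \<epsilon>"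
    using eps_pos by (intro mult_right_mono) auto
  then show ?thesis
    using eps_pos by (simp add: turn_def abs_mult)
qed

lemma abs_turn_le_half: "\<bar>turn k \<epsilon> j\<bar> \<le> 1 / 2"
  using abs_turn_le[of j] k_eps_le by linarith

lemma cos_turn_ge: "cos (turn k \<epsilon> j) \<ge> 7 / 8"
proof -
  have "(turn k \<epsilon> j)\<^sup>2 \<le> (1 / 2)\<^sup>2"
    using abs_turn_le_half[of j] by (subst abs_le_square_iff[symmetric]) simp
  then show ?thesis
    using cos_ge_one_minus_square[of "turn k \<epsilon> j"] by (simp add: power2_eq_square)
qed

lemma abs_sum_sin_turn_le:
  assumes "m \<le> k"
  shows "\<bar>\<Sum>j\<le>m. sin (turn k \<epsilon> j)\<bar> \<le> 1 / 2"
proof -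
  have "2 * \<bar>\<Sum>j\<le>m. sin (turn k \<epsilon> j)\<bar> \<le> (\<Sum>j\<le>k. \<bar>sin (turn k \<epsilon> j)\<bar>)"
    using sum_sin_turn assms by (rule twice_abs_partial_sum_le)
  also have "\<dots> \<le> (\<Sum>j\<le>k. real k * \<epsilon> / 2)"
    using abs_sin_x_le_abs_x abs_turn_le by (intro sum_mono) (rule order_trans)
  also have "\<dots> = (real k + 1) * (real k * \<epsilon> / 2)"
    by simp
  also have "\<dots> \<le> (2 * real k) * (real k * \<epsilon> / 2)"
    using k eps_pos by (intro mult_right_mono) auto
  also have "\<dots> \<le> 1"
    using eps_small by (simp add: power2_eq_square)
  finally show ?thesis
    by simp
qed

text \<open>The lower bound is \<open>k + 1\<close>, an upper bound for the length of the comparison tree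
  when \<open>\<eta>\<close> is small, times the relative gain that is claimed.\<close>

lemma sum_one_minus_cos_turn_gt:
  "(\<Sum>j\<le>k. 1 - cos (turn k \<epsilon> j)) > (real k)\<^sup>2 * \<epsilon>\<^sup>2 / 24 * (real k + 1)"
proof -
  \<comment> \<open>a bound for the relative error of \<open>\<theta>\<^sup>2 / 2\<close> as an approximation of \<open>1 - cos \<theta>\<close>, since \<open>\<theta>\<^sup>2 \<le> 1 / (4 * k\<^sup>2)\<close>\<close>
  define \<tau> where "\<tau> = 1 / (48 * (real k)\<^sup>2)"
  have "(turn k \<epsilon> j)\<^sup>2 / 2 * (1 - \<tau>) \<le> 1 - cos (turn k \<epsilon> j)" for j
  proof -
    have "\<bar>turn k \<epsilon> j\<bar> \<le> \<bar>1 / (2 * real k)\<bar>"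
    proof -
      have "\<bar>turn k \<epsilon> j\<bar> \<le> (1 / real k) / 2"
        using abs_turn_le[of j] k_eps_le(1) by (simp add: order_trans[OF _ less_imp_le])
      then show ?thesis
        by simp
    qed
    then have "(turn k \<epsilon> j)\<^sup>2 \<le> (1 / (2 * real k))\<^sup>2"
      unfolding abs_le_square_iff .
    then have "(turn k \<epsilon> j)\<^sup>2 / 12 \<le> \<tau>"
      by (simp add: \<tau>_def power_divide power_mult_distrib)
    then have "(turn k \<epsilon> j)\<^sup>2 / 2 * (1 - \<tau>) \<le> (turn k \<epsilon> j)\<^sup>2 / 2 * (1 - (turn k \<epsilon> j)\<^sup>2 / 12)"
      by (intro mult_left_mono) auto
    also have "\<dots> \<le> 1 - cos (turn k \<epsilon> j)"
      using abs_turn_le_half[of j] by (intro one_minus_cos_ge) auto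
    finally show ?thesis .
  qed
  then have "(\<Sum>j\<le>k. (turn k \<epsilon> j)\<^sup>2 / 2 * (1 - \<tau>)) \<le> (\<Sum>j\<le>k. 1 - cos (turn k \<epsilon> j))"
    by (intro sum_mono)
  also have "(\<Sum>j\<le>k. (turn k \<epsilon> j)\<^sup>2 / 2 * (1 - \<tau>)) = (\<Sum>j\<le>k. (turn k \<epsilon> j)\<^sup>2) * ((1 - \<tau>) / 2)"
    unfolding sum_distrib_right by (intro sum.cong) auto
  also have "\<dots> = (real k * \<epsilon>\<^sup>2 * (real k + 1) / 24) * ((real k + 2) * (1 - \<tau>))"
    unfolding sum_turn_square by simp
  finally have "(real k * \<epsilon>\<^sup>2 * (real k + 1) / 24) * ((real k + 2) * (1 - \<tau>))
      \<le> (\<Sum>j\<le>k. 1 - cos (turn k \<epsilon> j))" .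
  moreover have "real k < (real k + 2) * (1 - \<tau>)"
  proof -
    have "real k * 1 \<le> (real k)\<^sup>2" "1 \<le> (real k)\<^sup>2"
      using k one_le_power[of "real k" 2] by (simp_all add: power2_eq_square)
    then have "real k + 2 < 2 * (48 * (real k)\<^sup>2)"
      by linarith
    then have "(real k + 2) * \<tau> < 2"
      using k by (simp add: \<tau>_def field_simps)
    then show ?thesis
      by (simp add: algebra_simps)
  qed
  then have "(real k * \<epsilon>\<^sup>2 * (real k + 1) / 24) * real k
      < (real k * \<epsilon>\<^sup>2 * (real k + 1) / 24) * ((real k + 2) * (1 - \<tau>))"
    using k eps_pos by (intro mult_strict_left_mono) auto
  moreover have "(real k)\<^sup>2 * \<epsilon>\<^sup>2 / 24 * (real k + 1)
      = (real k * \<epsilon>\<^sup>2 * (real k + 1) / 24) * real k"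
    by (simp add: power2_eq_square)
  ultimately show ?thesis
    by linarith
qed

end

section \<open>The two trees\<close>

text \<open>The length of the edges at depth \<open>j\<close>, where \<open>\<eta>\<close> is that of the extra edges.\<close>

definition edge_length :: "nat \<Rightarrow> real \<Rightarrow> nat \<Rightarrow> real" where
  "edge_length k \<eta> j = (if j \<le> k then 1 / 2 ^ j else \<eta>)"

text \<open>The exact direction of the edge from \<open>i div 2\<close> to \<open>i\<close>; the value at \<open>0\<close> is irrelevant.\<close>

fun heap_angle :: "nat \<Rightarrow> real" where
  "heap_angle i = (if i \<le> 1 then 0 else heap_angle (i div 2) + (if even i then pi / 3 else - pi / 3))"

declare heap_angle.simps [simp del]

text \<open>The approximate tree, whose edges at depth \<open>j\<close> are turned by \<open>turn k \<epsilon> j\<close> from the exact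
  directions. The edge from \<open>i div 2\<close> to \<open>i\<close> has depth \<open>floor_log i\<close>.\<close>

fun turned_pos :: "nat \<Rightarrow> real \<Rightarrow> real \<Rightarrow> nat \<Rightarrow> complex" where
  "turned_pos k \<epsilon> \<eta> i = (if i = 0 then 0 else turned_pos k \<epsilon> \<eta> (i div 2)
     + rcis (edge_length k \<eta> (floor_log i)) (heap_angle i + turn k \<epsilon> (floor_log i)))"

declare turned_pos.simps [simp del]

text \<open>The displacement of the vertices at depth \<open>j\<close>, counterclockwise perpendicular to the exact
  direction of their parent edges.\<close>

definition shift :: "nat \<Rightarrow> real \<Rightarrow> nat \<Rightarrow> real" where
  "shift k \<epsilon> j = (if j < k then - (\<Sum>m\<le>j. sin (turn k \<epsilon> m)) / 2 ^ j else 0)"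

text \<open>The comparison tree, whose edges up to depth \<open>k\<close> have the exact directions; the deeper ones are
  those of the approximate tree.\<close>

definition exact_pos :: "nat \<Rightarrow> real \<Rightarrow> real \<Rightarrow> nat \<Rightarrow> complex" where
  "exact_pos k \<epsilon> \<eta> i = turned_pos k \<epsilon> \<eta> i
     + (if i = 0 then 0 else \<i> * shift k \<epsilon> (floor_log i) * cis (heap_angle i))"

text \<open>The ratio of the total lengths of the edges at depth \<open>j\<close> in the comparison tree and in the
  approximate tree.\<close>

definition contraction :: "nat \<Rightarrow> real \<Rightarrow> nat \<Rightarrow> real" where
  "contraction k \<epsilon> j = (if j \<le> k then cos (turn k \<epsilon> j) else 1)"

lemma heap_angle_child:
  assumes "s \<ge> 1"
  shows "heap_angle (2 * s) = heap_angle s + pi / 3"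
    "heap_angle (2 * s + 1) = heap_angle s - pi / 3"
  using assms heap_angle.simps[of "2 * s"] heap_angle.simps[of "2 * s + 1"] by simp_all

lemma turned_pos_diff:
  assumes "i \<ge> 1"
  shows "turned_pos k \<epsilon> \<eta> i - turned_pos k \<epsilon> \<eta> (i div 2)
    = rcis (edge_length k \<eta> (floor_log i)) (heap_angle i + turn k \<epsilon> (floor_log i))"
  using assms by (simp add: turned_pos.simps[of k \<epsilon> \<eta> i])

lemma edge_length_pos:
  assumes "\<eta> > 0"
  shows "edge_length k \<eta> j > 0"
  using assms by (simp add: edge_length_def)

lemma dist_turned_pos:
  assumes "i \<ge> 1" "\<eta> > 0"
  shows "dist (turned_pos k \<epsilon> \<eta> (i div 2)) (turned_pos k \<epsilon> \<eta> i) = edge_length k \<eta> (floor_log i)"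
  using turned_pos_diff[OF assms(1), of k \<epsilon> \<eta>] edge_length_pos[OF assms(2), of k "floor_log i"]
  by (simp add: dist_norm norm_minus_commute)

lemma shift_rec:
  assumes "1 \<le> j" "j \<le> k"
  shows "shift k \<epsilon> j = shift k \<epsilon> (j - 1) / 2 - sin (turn k \<epsilon> j) / 2 ^ j"
proof -
  obtain j' where j: "j = Suc j'"
    using assms(1) by (cases j) auto
  have "shift k \<epsilon> j = - (\<Sum>m\<le>j. sin (turn k \<epsilon> m)) / 2 ^ j"
    using assms(2) sum_sin_turn[of k \<epsilon>] by (cases "j = k") (auto simp: shift_def)
  then show ?thesis
    using assms j by (simp add: shift_def field_simps)
qed

lemma floor_log_double_add_one:
  assumes "s \<ge> 1"
  shows "floor_log (2 * s + 1) = Suc (floor_log s)"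
  using assms floor_log_rec[of "2 * s + 1"] by simp

context
  fixes k n :: nat and \<epsilon> \<eta> :: real
  assumes k: "k \<ge> 1" and n: "2 ^ k + 1 \<le> n"
    and eps_pos: "\<epsilon> > 0" and eps_small: "(real k)\<^sup>2 * \<epsilon> < 1"
    and eta_pos: "\<eta> > 0"
begin

lemma n_ge_3: "n \<ge> 3"
proof -
  have "(2 :: nat) ^ 1 \<le> 2 ^ k"
    using k by (intro power_increasing) auto
  with n show ?thesis
    by simp
qed

lemma approx_steiner_turned:
  "approx_steiner \<epsilon> (heap_topology n) (plane_of_complex \<circ> turned_pos k \<epsilon> \<eta>)"
proof -
  let ?P = "turned_pos k \<epsilon> \<eta>"
  let ?p = "plane_of_complex \<circ> ?P"
  let ?l = "edge_length k \<eta>"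
  let ?I = "{2 * pi / 3 - \<epsilon> .. 2 * pi / 3 + \<epsilon>}"
  have main: "?p u \<noteq> ?p s"
      "{s, v} \<in> edges (heap_topology n) \<Longrightarrow> u \<noteq> v \<Longrightarrow> vec_angle (?p u - ?p s) (?p v - ?p s) \<in> ?I"
    if s: "s \<ge> 1" and u: "{s, u} \<in> edges (heap_topology n)" for s u v
  proof -
    define j where "j = floor_log s"
    define \<delta> where "\<delta> = turn k \<epsilon> (Suc j) - turn k \<epsilon> j"
    define \<phi> where "\<phi> = heap_angle s + turn k \<epsilon> j"
    have "\<delta> = (if j < k then \<epsilon> else 0)"
      by (auto simp: \<delta>_def turn_def min_def algebra_simps)
    then have \<delta>: "0 \<le> \<delta>" "\<delta> \<le> \<epsilon>"
      using eps_pos by auto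
    have "\<epsilon> \<le> real k * \<epsilon>"
      using k eps_pos by simp
    then have "\<epsilon> < 1"
      using k_eps_le(2)[OF k eps_pos eps_small] by linarith
    then have \<delta>pi: "\<delta> \<le> pi / 3"
      using \<delta> pi_gt3 by linarith
    have parent: "?p (s div 2) - ?p s = plane_of_complex (rcis (?l j) (\<phi> - pi))"
    proof -
      have "?P (s div 2) - ?P s = - rcis (?l j) \<phi>"
        using turned_pos_diff[OF s, of k \<epsilon> \<eta>] by (simp add: j_def \<phi>_def algebra_simps)
      also have "\<dots> = rcis (?l j) (\<phi> - pi)"
        by (simp add: complex_eq_iff cos_diff sin_diff)
      finally show ?thesis
        by (simp add: plane_of_complex_diff)
    qed
    have even: "?p (2 * s) - ?p s = plane_of_complex (rcis (?l (Suc j)) (\<phi> + pi / 3 + \<delta>))"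
      using turned_pos_diff[of "2 * s" k \<epsilon> \<eta>] s heap_angle_child(1)[OF s]
      by (simp add: plane_of_complex_diff j_def \<phi>_def \<delta>_def add_ac)
    have odd: "?p (2 * s + 1) - ?p s = plane_of_complex (rcis (?l (Suc j)) (\<phi> - pi / 3 + \<delta>))"
      using turned_pos_diff[of "2 * s + 1" k \<epsilon> \<eta>] s floor_log_double_add_one[OF s] heap_angle_child(2)[OF s]
      by (simp add: plane_of_complex_diff j_def \<phi>_def \<delta>_def add_ac)
    note l = edge_length_pos[OF eta_pos]
    have a1: "vec_angle (?p (s div 2) - ?p s) (?p (2 * s) - ?p s) = 2 * pi / 3 - \<delta>"
    proof -
      have "cos ((\<phi> - pi) - (\<phi> + pi / 3 + \<delta>)) = cos (- (2 * pi - (2 * pi / 3 - \<delta>)))"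
        by (rule arg_cong[where f = cos]) (simp add: algebra_simps)
      also have "\<dots> = cos (2 * pi / 3 - \<delta>)"
        by (simp only: cos_minus cos_2pi_minus)
      finally have "cos ((\<phi> - pi) - (\<phi> + pi / 3 + \<delta>)) = cos (2 * pi / 3 - \<delta>)" .
      moreover have "arccos (cos (2 * pi / 3 - \<delta>)) = 2 * pi / 3 - \<delta>"
        using \<delta> \<delta>pi pi_gt_zero by (intro arccos_cos) linarith+
      ultimately show ?thesis
        unfolding parent even vec_angle_plane_rcis[OF l l] by (simp only:)
    qed
    have a2: "vec_angle (?p (s div 2) - ?p s) (?p (2 * s + 1) - ?p s) = 2 * pi / 3 + \<delta>"
    proof -
      have "cos ((\<phi> - pi) - (\<phi> - pi / 3 + \<delta>)) = cos (- (2 * pi / 3 + \<delta>))"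
        by (rule arg_cong[where f = cos]) (simp add: algebra_simps)
      also have "\<dots> = cos (2 * pi / 3 + \<delta>)"
        by (simp only: cos_minus)
      finally have "cos ((\<phi> - pi) - (\<phi> - pi / 3 + \<delta>)) = cos (2 * pi / 3 + \<delta>)" .
      moreover have "arccos (cos (2 * pi / 3 + \<delta>)) = 2 * pi / 3 + \<delta>"
        using \<delta> \<delta>pi pi_gt_zero by (intro arccos_cos) linarith+
      ultimately show ?thesis
        unfolding parent odd vec_angle_plane_rcis[OF l l] by (simp only:)
    qed
    have a3: "vec_angle (?p (2 * s) - ?p s) (?p (2 * s + 1) - ?p s) = 2 * pi / 3"
    proof -
      have "(\<phi> + pi / 3 + \<delta>) - (\<phi> - pi / 3 + \<delta>) = 2 * pi / 3"
        by (simp add: algebra_simps)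
      moreover have "arccos (cos (2 * pi / 3)) = 2 * pi / 3"
        using pi_gt_zero by (intro arccos_cos) linarith+
      ultimately show ?thesis
        unfolding even odd vec_angle_plane_rcis[OF l l] by (simp only:)
    qed
    have nz: "plane_of_complex (rcis a x) \<noteq> 0" if "a > 0" for a x
      using that norm_plane_of_complex[of "rcis a x"] by auto
    have u3: "u = s div 2 \<or> u = 2 * s \<or> u = 2 * s + 1"
      using u s by (rule heap_neighbours)
    then have "?p u - ?p s \<noteq> 0"
      using parent even odd nz l by metis
    then show "?p u \<noteq> ?p s"
      by simp
    assume v: "{s, v} \<in> edges (heap_topology n)" "u \<noteq> v"
    then have v3: "v = s div 2 \<or> v = 2 * s \<or> v = 2 * s + 1"
      using s by (intro heap_neighbours)
    have "2 * pi / 3 - \<delta> \<in> ?I" "2 * pi / 3 + \<delta> \<in> ?I" "2 * pi / 3 \<in> ?I"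
      using \<delta> by auto
    then show "vec_angle (?p u - ?p s) (?p v - ?p s) \<in> ?I"
      using u3 v3 v(2) a1 a2 a3 vec_angle_commute by metis
  qed
  then show ?thesis
    using n_ge_3 by (auto simp: approx_steiner_def heap_steiner_points)
qed

lemma tree_length_turned:
  "tree_length (heap_topology n) (plane_of_complex \<circ> turned_pos k \<epsilon> \<eta>)
    = (\<Sum>i = 1..2 * n - 3. edge_length k \<eta> (floor_log i))"
  by (simp add: heap_tree_length dist_plane_of_complex dist_turned_pos eta_pos)

lemma dist_exact_pos_root:
  "dist (exact_pos k \<epsilon> \<eta> 0) (exact_pos k \<epsilon> \<eta> 1) = edge_length k \<eta> 0 * contraction k \<epsilon> 0"
proof -
  have "exact_pos k \<epsilon> \<eta> 1 - exact_pos k \<epsilon> \<eta> 0 = cos (turn k \<epsilon> 0)"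
    using k by (simp add: exact_pos_def shift_def turned_pos.simps heap_angle.simps edge_length_def
        complex_eq_iff)
  moreover have "cos (turn k \<epsilon> 0) > 0"
    using cos_turn_ge[OF k eps_pos eps_small, of 0] by linarith
  ultimately show ?thesis
    by (subst dist_commute) (simp add: dist_norm edge_length_def contraction_def)
qed

text \<open>For an edge of depth at most \<open>k\<close>, the recursion for \<open>shift\<close> says that the component of the
  moved edge perpendicular to its exact direction vanishes. The displacement of its upper end has a component along that direction,
  with opposite signs for the two children of a vertex; \<open>abs_sum_sin_turn_le\<close> and \<open>cos_turn_ge\<close>
  show that it is too small to reverse the edge.\<close>

lemma dist_exact_pos:
  assumes i: "i \<ge> 2"
  shows "dist (exact_pos k \<epsilon> \<eta> (i div 2)) (exact_pos k \<epsilon> \<eta> i)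
    = edge_length k \<eta> (floor_log i) * contraction k \<epsilon> (floor_log i)
      - (if even i then 1 else -1) * sqrt 3 / 2 * shift k \<epsilon> (floor_log i - 1)"
proof -
  define j where "j = floor_log i"
  define \<sigma> :: real where "\<sigma> = (if even i then 1 else -1)"
  have j: "j \<ge> 1" "floor_log (i div 2) = j - 1"
    using i floor_log_rec[of i] by (auto simp: j_def)
  show ?thesis
  proof (cases "j \<le> k")
    case False
    then have "shift k \<epsilon> j = 0" "shift k \<epsilon> (j - 1) = 0"
      by (auto simp: shift_def)
    then show ?thesis
      using dist_turned_pos[of i \<eta> k \<epsilon>] i j False eta_pos by (auto simp: exact_pos_def j_def contraction_def)
  next
    case True
    define A where "A = heap_angle i"
    define b where "b = shift k \<epsilon> (j - 1)"
    define \<theta> where "\<theta> = turn k \<epsilon> j"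
    define \<mu> where "\<mu> = cos \<theta> / 2 ^ j - \<sigma> * sqrt 3 / 2 * b"
    have "heap_angle (i div 2) = A - \<sigma> * (pi / 3)"
      using i by (simp add: A_def \<sigma>_def heap_angle.simps[of i])
    then have "cis (heap_angle (i div 2)) = cis A * Complex (1 / 2) (- \<sigma> * sqrt 3 / 2)"
      by (cases "even i") (simp_all add: \<sigma>_def complex_eq_iff cos_diff sin_diff cos_add sin_add cos_60 sin_60)
    moreover have "shift k \<epsilon> j = b / 2 - sin \<theta> / 2 ^ j"
      unfolding b_def \<theta>_def using j True by (intro shift_rec) auto
    moreover have "turned_pos k \<epsilon> \<eta> i - turned_pos k \<epsilon> \<eta> (i div 2)
        = cis A * Complex (cos \<theta> / 2 ^ j) (sin \<theta> / 2 ^ j)"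
      using turned_pos_diff[of i k \<epsilon> \<eta>] i True
      by (simp add: A_def \<theta>_def j_def edge_length_def complex_eq_iff cos_add sin_add field_simps)
    moreover have "exact_pos k \<epsilon> \<eta> i - exact_pos k \<epsilon> \<eta> (i div 2)
        = (turned_pos k \<epsilon> \<eta> i - turned_pos k \<epsilon> \<eta> (i div 2))
          + \<i> * shift k \<epsilon> j * cis A - \<i> * b * cis (heap_angle (i div 2))"
      using i j by (simp add: exact_pos_def A_def b_def j_def)
    ultimately have "exact_pos k \<epsilon> \<eta> i - exact_pos k \<epsilon> \<eta> (i div 2)
        = cis A * Complex (cos \<theta> / 2 ^ j) (sin \<theta> / 2 ^ j)
          + \<i> * complex_of_real (b / 2 - sin \<theta> / 2 ^ j) * cis A
          - \<i> * b * (cis A * Complex (1 / 2) (- \<sigma> * sqrt 3 / 2))"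
      by simp
    also have "\<dots> = cis A * (Complex (cos \<theta> / 2 ^ j) (sin \<theta> / 2 ^ j)
          + \<i> * complex_of_real (b / 2 - sin \<theta> / 2 ^ j)
          - \<i> * b * Complex (1 / 2) (- \<sigma> * sqrt 3 / 2))"
      by (simp add: algebra_simps)
    also have "\<dots> = cis A * \<mu>"
      by (rule arg_cong[where f = "\<lambda>z. cis A * z"]) (simp add: complex_eq_iff \<mu>_def)
    finally have "dist (exact_pos k \<epsilon> \<eta> (i div 2)) (exact_pos k \<epsilon> \<eta> i) = \<bar>\<mu>\<bar>"
      by (subst dist_commute) (simp add: dist_norm norm_mult)
    moreover have "\<mu> \<ge> 0"
    proof -
      have "b = - (\<Sum>m\<le>j - 1. sin (turn k \<epsilon> m)) / 2 ^ (j - 1)"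
        using True j by (simp add: b_def shift_def)
      then have "\<bar>b\<bar> * 2 ^ j = 2 * \<bar>\<Sum>m\<le>j - 1. sin (turn k \<epsilon> m)\<bar>"
        using j(1) by (cases j) (simp_all add: abs_mult)
      also have "\<dots> \<le> 1"
      proof -
        have "\<bar>\<Sum>m\<le>j - 1. sin (turn k \<epsilon> m)\<bar> \<le> 1 / 2"
          using True by (intro abs_sum_sin_turn_le[OF k eps_pos eps_small]) simp
        then show ?thesis
          by linarith
      qed
      finally have b: "\<bar>b\<bar> \<le> 1 / 2 ^ j"
        by (simp add: field_simps)
      have "sqrt 3 \<le> 7 / 4"
        by (rule real_le_lsqrt) (auto simp: power2_eq_square)
      then have "sqrt 3 / 2 * \<bar>b\<bar> \<le> 7 / 8 * (1 / 2 ^ j)"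
        using b by (intro mult_mono) auto
      also have "\<dots> \<le> cos \<theta> * (1 / 2 ^ j)"
        using cos_turn_ge[OF k eps_pos eps_small, of j] by (intro mult_right_mono) (auto simp: \<theta>_def)
      finally have "sqrt 3 / 2 * \<bar>b\<bar> \<le> cos \<theta> / 2 ^ j"
        by simp
      moreover have "\<sigma> * sqrt 3 / 2 * b \<le> sqrt 3 / 2 * \<bar>b\<bar>"
        by (simp add: \<sigma>_def abs_ge_self abs_ge_minus_self)
      ultimately show ?thesis
        unfolding \<mu>_def by linarith
    qed
    ultimately show ?thesis
      using True by (simp add: \<mu>_def b_def \<sigma>_def \<theta>_def j_def edge_length_def contraction_def)
  qed
qed

lemma tree_length_exact:
  "tree_length (heap_topology n) (plane_of_complex \<circ> exact_pos k \<epsilon> \<eta>)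
    = (\<Sum>i = 1..2 * n - 3. edge_length k \<eta> (floor_log i) * contraction k \<epsilon> (floor_log i))"
proof -
  let ?d = "\<lambda>i. dist (exact_pos k \<epsilon> \<eta> (i div 2)) (exact_pos k \<epsilon> \<eta> i)"
  let ?w = "\<lambda>i. edge_length k \<eta> (floor_log i) * contraction k \<epsilon> (floor_log i)"
  have N: "2 * n - 3 = 2 * (n - 2) + 1"
    using n_ge_3 by simp
  \<comment> \<open>the corrections for two siblings cancel\<close>
  have "?d (2 * i) + ?d (2 * i + 1) = ?w (2 * i) + ?w (2 * i + 1)" if "i \<ge> 1" for i
    using that dist_exact_pos[of "2 * i"] dist_exact_pos[of "2 * i + 1"]
      floor_log_double_add_one[OF that] by simp
  then have "(\<Sum>i = 1..2 * n - 3. ?d i) = (\<Sum>i = 1..2 * n - 3. ?w i)"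
    unfolding N sum_heap_children using dist_exact_pos_root by simp
  then show ?thesis
    by (simp add: heap_tree_length dist_plane_of_complex)
qed

lemma two_power_le: "2 ^ Suc k \<le> 2 * n - 3 + 1"
  using n by simp

lemma tree_length_diff:
  "tree_length (heap_topology n) (plane_of_complex \<circ> turned_pos k \<epsilon> \<eta>)
    - tree_length (heap_topology n) (plane_of_complex \<circ> exact_pos k \<epsilon> \<eta>)
    = (\<Sum>j\<le>k. 1 - cos (turn k \<epsilon> j))"
proof -
  let ?f = "\<lambda>j. edge_length k \<eta> j * (1 - contraction k \<epsilon> j)"
  have "tree_length (heap_topology n) (plane_of_complex \<circ> turned_pos k \<epsilon> \<eta>)
      - tree_length (heap_topology n) (plane_of_complex \<circ> exact_pos k \<epsilon> \<eta>)
      = (\<Sum>i = 1..2 * n - 3. ?f (floor_log i))"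
    unfolding tree_length_turned tree_length_exact sum_subtractf[symmetric]
    by (simp add: right_diff_distrib)
  also have "\<dots> = (\<Sum>i = 1..<2 ^ Suc k. ?f (floor_log i))"
  proof (rule sum.mono_neutral_right)
    show "{1..<2 ^ Suc k} \<subseteq> {1..2 * n - 3}"
      using two_power_le by auto
    show "\<forall>i\<in>{1..2 * n - 3} - {1..<2 ^ Suc k}. ?f (floor_log i) = 0"
    proof
      fix i
      assume "i \<in> {1..2 * n - 3} - {1..<2 ^ Suc k}"
      then have "floor_log (2 ^ Suc k) \<le> floor_log i"
        by (intro floor_log_le_iff) auto
      then show "?f (floor_log i) = 0"
        unfolding floor_log_power by (simp add: contraction_def)
    qed
  qed auto
  also have "\<dots> = (\<Sum>j<Suc k. 2 ^ j * ?f j)"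
    by (rule sum_heap_levels)
  also have "\<dots> = (\<Sum>j\<le>k. 1 - cos (turn k \<epsilon> j))"
    unfolding lessThan_Suc_atMost
    by (intro sum.cong) (auto simp: edge_length_def contraction_def)
  finally show ?thesis .
qed

lemma tree_length_turned_le:
  "tree_length (heap_topology n) (plane_of_complex \<circ> turned_pos k \<epsilon> \<eta>) \<le> real k + 1 + 2 * real n * \<eta>"
proof -
  let ?l = "\<lambda>i. edge_length k \<eta> (floor_log i)"
  have "(\<Sum>i = 1..2 * n - 3. ?l i) = (\<Sum>i = 1..<2 ^ Suc k. ?l i) + (\<Sum>i = 2 ^ Suc k..2 * n - 3. ?l i)"
  proof -
    have "{1..2 * n - 3} = {1..<2 ^ Suc k} \<union> {2 ^ Suc k..2 * n - 3}"
    proof -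
      have "1 \<le> x" if "2 ^ Suc k \<le> x" for x :: nat
        using one_le_power[of "2 :: nat" "Suc k"] that by linarith
      then show ?thesis
        using two_power_le by (fastforce simp del: power_Suc One_nat_def)
    qed
    then show ?thesis
      by (simp add: sum.union_disjoint disjoint_iff)
  qed
  also have "(\<Sum>i = 1..<2 ^ Suc k. ?l i) = (\<Sum>j<Suc k. 2 ^ j * edge_length k \<eta> j)"
    by (rule sum_heap_levels)
  also have "\<dots> = (\<Sum>j<Suc k. 1)"
    by (intro sum.cong) (auto simp: edge_length_def)
  also have "\<dots> = real k + 1"
    by simp
  also have "(\<Sum>i = 2 ^ Suc k..2 * n - 3. ?l i) \<le> (\<Sum>i = 2 ^ Suc k..2 * n - 3. \<eta>)"
  proof (rule sum_mono)
    fix i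
    assume "i \<in> {2 ^ Suc k..2 * n - 3}"
    then have "floor_log (2 ^ Suc k) \<le> floor_log i"
      by (intro floor_log_le_iff) auto
    then show "?l i \<le> \<eta>"
      unfolding floor_log_power by (simp add: edge_length_def)
  qed
  also have "\<dots> = real (card {2 ^ Suc k..2 * n - 3}) * \<eta>"
    by simp
  also have "\<dots> \<le> 2 * real n * \<eta>"
  proof (rule mult_right_mono)
    have "card {2 ^ Suc k..2 * n - 3} \<le> 2 * n"
      using n_ge_3 unfolding card_atLeastAtMost by linarith
    then show "real (card {2 ^ Suc k..2 * n - 3}) \<le> 2 * real n"
      by linarith
  qed (use eta_pos in simp)
  finally show ?thesis
    unfolding tree_length_turned by simp
qed

lemma exact_pos_terminal:
  assumes "t \<in> set (terminals (heap_topology n))"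
  shows "exact_pos k \<epsilon> \<eta> t = turned_pos k \<epsilon> \<eta> t"
proof (cases "t = 0")
  case False
  with assms have "2 ^ k \<le> t"
    using n by (auto simp: heap_topology_def)
  then have "floor_log (2 ^ k) \<le> floor_log t"
    by (rule floor_log_le_iff)
  then show ?thesis
    by (simp add: exact_pos_def shift_def)
qed (simp add: exact_pos_def)

end

section \<open>The lower bounds\<close>

lemma steiner_F_plane_gt:
  assumes k: "k \<ge> 1" and n: "2 ^ k + 1 \<le> n" and eps: "\<epsilon> > 0" "(real k)\<^sup>2 * \<epsilon> < 1"
  shows "ereal ((real k)\<^sup>2 * \<epsilon>\<^sup>2 / 24) < steiner_F TYPE(2) \<epsilon> n"
proof -
  define g where "g = (\<Sum>j\<le>k. 1 - cos (turn k \<epsilon> j))"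
  have g: "(real k)\<^sup>2 * \<epsilon>\<^sup>2 / 24 * (real k + 1) < g"
    unfolding g_def by (rule sum_one_minus_cos_turn_gt[OF k eps])
  moreover have "0 \<le> (real k)\<^sup>2 * \<epsilon>\<^sup>2 / 24 * (real k + 1)"
    by simp
  ultimately have g_pos: "g > 0"
    by linarith
  \<comment> \<open>the extra edges are so short that their total length is at most the gain \<open>g\<close>\<close>
  define \<eta> where "\<eta> = g / (2 * real n)"
  have "real n > 0"
    using n by simp
  then have \<eta>: "\<eta> > 0" "2 * real n * \<eta> = g"
    using g_pos by (auto simp: \<eta>_def)
  note asms = k n eps \<eta>(1)
  let ?p = "plane_of_complex \<circ> turned_pos k \<epsilon> \<eta>"
  let ?q = "plane_of_complex \<circ> exact_pos k \<epsilon> \<eta>"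
  have diff: "tree_length (heap_topology n) ?p - tree_length (heap_topology n) ?q = g"
    unfolding g_def by (rule tree_length_diff[OF asms])
  show ?thesis
  proof (rule steiner_F_gt)
    show "(heap_topology n, ?p) \<in> full_approx_trees \<epsilon> n"
      using heap_full_steiner_topology[OF n_ge_3[OF asms]] approx_steiner_turned[OF asms]
      by (simp add: full_approx_trees_def)
    show "?q t = ?p t" if "t \<in> set (terminals (heap_topology n))" for t
      using exact_pos_terminal[OF asms that] by simp
    show "tree_length (heap_topology n) ?q < tree_length (heap_topology n) ?p"
      using diff g_pos by linarith
    show "tree_length (heap_topology n) ?q \<le> real k + 1"
      using tree_length_turned_le[OF asms] diff \<eta>(2) by linarith
    show "(real k)\<^sup>2 * \<epsilon>\<^sup>2 / 24 * (real k + 1)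
        < tree_length (heap_topology n) ?p - tree_length (heap_topology n) ?q"
      using g diff by simp
  qed simp
qed

theorem theorem4p3:
  shows "(\<forall>(k::nat) (\<epsilon>::real) (c::real).
            1 \<le> k \<longrightarrow> 0 < c \<longrightarrow> c < 1 \<longrightarrow> \<epsilon> = c / (real k)\<^sup>2 \<longrightarrow>
            steiner_F TYPE(2) \<epsilon> (2 ^ k + 1) > ereal (c / 24 * \<epsilon>))
       \<and> (\<exists>c\<^sub>0::real. 0 < c\<^sub>0 \<and>
            (\<forall>(n::nat) (\<epsilon>::real).
               3 \<le> n \<longrightarrow> 0 < \<epsilon> \<longrightarrow> \<epsilon> < 1 / (log 2 (real n))\<^sup>2 \<longrightarrow>
               steiner_F TYPE(2) \<epsilon> n \<ge> ereal (c\<^sub>0 * (ln (real n))\<^sup>2 * \<epsilon>\<^sup>2)))"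
proof (rule conjI)
  show "\<forall>(k::nat) (\<epsilon>::real) (c::real).
      1 \<le> k \<longrightarrow> 0 < c \<longrightarrow> c < 1 \<longrightarrow> \<epsilon> = c / (real k)\<^sup>2 \<longrightarrow>
      steiner_F TYPE(2) \<epsilon> (2 ^ k + 1) > ereal (c / 24 * \<epsilon>)"
  proof (intro allI impI)
    fix k :: nat and \<epsilon> c :: real
    assume k: "1 \<le> k" and c: "0 < c" "c < 1" and \<epsilon>: "\<epsilon> = c / (real k)\<^sup>2"
    have *: "(real k)\<^sup>2 * \<epsilon> = c" "\<epsilon> > 0"
      using k c \<epsilon> by auto
    then have "c / 24 * \<epsilon> = (real k)\<^sup>2 * \<epsilon>\<^sup>2 / 24"
      by (simp add: power2_eq_square)
    then show "steiner_F TYPE(2) \<epsilon> (2 ^ k + 1) > ereal (c / 24 * \<epsilon>)"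
      using steiner_F_plane_gt[of k "2 ^ k + 1" \<epsilon>] k c * by simp
  qed
  have "ereal (1 / 96 * (ln (real n))\<^sup>2 * \<epsilon>\<^sup>2) \<le> steiner_F TYPE(2) \<epsilon> n"
    if n: "3 \<le> n" and \<epsilon>: "0 < \<epsilon>" "\<epsilon> < 1 / (log 2 (real n))\<^sup>2" for n :: nat and \<epsilon> :: real
  proof -
    define k where "k = floor_log (n - 1)"
    have "floor_log 2 \<le> k"
      unfolding k_def using n by (intro floor_log_le_iff) auto
    then have k: "k \<ge> 1"
      using floor_log_power[of 1] by simp
    have lower: "2 ^ k + 1 \<le> n"
      using floor_log_exp2_le[of "n - 1"] n by (simp add: k_def)
    have upper: "n \<le> 2 ^ Suc k"
      using floor_log_exp2_gt[of "n - 1"] by (simp add: k_def)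
    have "real k = log 2 (2 ^ k)"
      by simp
    also have "\<dots> \<le> log 2 (real n)"
    proof -
      have "real (2 ^ k) \<le> real n"
        using lower by (subst of_nat_le_iff) simp
      then have "(2 :: real) ^ k \<le> real n"
        by simp
      then show ?thesis
        using n by (intro log_mono) auto
    qed
    finally have k_le: "real k \<le> log 2 (real n)" .
    then have "(real k)\<^sup>2 * \<epsilon> \<le> (log 2 (real n))\<^sup>2 * \<epsilon>"
      using \<epsilon> by (intro mult_right_mono power_mono) auto
    also have "\<dots> < 1"
      using \<epsilon> k k_le by (simp add: field_simps)
    finally have small: "(real k)\<^sup>2 * \<epsilon> < 1" .
    have "ln (real n) \<le> ln (2 ^ Suc k)"
    proof -
      have "real n \<le> real (2 ^ Suc k)"
        using upper by (subst of_nat_le_iff)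
      then have "real n \<le> 2 ^ Suc k"
        by simp
      then show ?thesis
        using n by (intro ln_mono) auto
    qed
    also have "\<dots> = (real k + 1) * ln 2"
      by (simp add: ln_realpow algebra_simps del: power_Suc)
    also have "\<dots> \<le> (2 * real k) * 1"
      using k ln_2_less_1 by (intro mult_mono) auto
    finally have "(ln (real n))\<^sup>2 \<le> (2 * real k)\<^sup>2"
      using n by (intro power_mono) auto
    then have "1 / 96 * (ln (real n))\<^sup>2 * \<epsilon>\<^sup>2 \<le> 1 / 96 * (2 * real k)\<^sup>2 * \<epsilon>\<^sup>2"
      by (intro mult_right_mono mult_left_mono) auto
    also have "\<dots> = (real k)\<^sup>2 * \<epsilon>\<^sup>2 / 24"
      by (simp add: power_mult_distrib)
    finally show ?thesis
      using steiner_F_plane_gt[OF k lower \<epsilon>(1) small] by (meson ereal_less_eq(3) less_imp_le order_trans)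
  qed
  then show "\<exists>c\<^sub>0::real. 0 < c\<^sub>0 \<and>
      (\<forall>(n::nat) (\<epsilon>::real).
         3 \<le> n \<longrightarrow> 0 < \<epsilon> \<longrightarrow> \<epsilon> < 1 / (log 2 (real n))\<^sup>2 \<longrightarrow>
         steiner_F TYPE(2) \<epsilon> n \<ge> ereal (c\<^sub>0 * (ln (real n))\<^sup>2 * \<epsilon>\<^sup>2))"
    by (intro exI[of _ "1 / 96"]) auto
qed

end
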